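(* Let $(X,d)$ be a nonempty complete metric space and let $f:X\to\mathbb{R}\cup\{+\infty\}$ be a lower semicontinuous function with $\inf_X f>-\infty$. If there exists $\sigma>0$ such that $$\sup\{f^\downarrow(x):\ x\in X,\ f(x)>\inf_X f,\ f(x)<+\infty\}<-\sigma,$$ then $\mathrm{Argmin}(f)\neq\varnothing$.
   Context: $B(x,r)$ denotes the closed ball with center $x$ and radius $r$. For $x$ with $f(x)$ finite, the steepest descent rate of $f$ at $x$ is $f^\downarrow(x)=\liminf_{y\to x}\frac{f(y)-f(x)}{d(y,x)}=\sup_{\delta>0}\inf_{y\in B(x,\delta)\setminus\{x\}}\frac{f(y)-f(x)}{d(y,x)}$ (with $\inf\varnothing=+\infty$). The supremum over the empty set is $-\infty$. $\mathrm{Argmin}(f)=\{x\in X:\ f(x)\le\inf_X f\}$ is the set of global minimizers of $f$ (equal to $X$ if $f\equiv+\infty$). *)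

theory Defs
  imports "HOL-Analysis.Analysis"
begin

(* At an isolated point "at x" is the trivial filter and Liminf is \<infinity>, so every
   function is lower semicontinuous there. *)
definition lower_semicontinuous :: "('a::topological_space \<Rightarrow> ereal) \<Rightarrow> bool" where
  "lower_semicontinuous f \<longleftrightarrow> (\<forall>x. f x \<le> Liminf (at x) f)"

(* Meaningful only when f x is finite. At an isolated point the value is \<infinity>, in
   agreement with the convention that the infimum of the empty set is \<infinity>. *)
definition steepest_descent_rate :: "('a::metric_space \<Rightarrow> ereal) \<Rightarrow> 'a \<Rightarrow> ereal" where
  "steepest_descent_rate f x = Liminf (at x) (\<lambda>y. (f y - f x) / ereal (dist y x))"

lemma steepest_descent_rate_eq_SUP_INF_cball:
  "steepest_descent_rate f x =
     (SUP \<delta>\<in>{0<..}. INF y\<in>cball x \<delta> - {x}. (f y - f x) / ereal (dist y x))"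
  unfolding steepest_descent_rate_def Liminf_at
proof (rule antisym)
  let ?q = "\<lambda>y. (f y - f x) / ereal (dist y x)"
  show "(SUP e\<in>{0<..}. INF y\<in>ball x e - {x}. ?q y)
      \<le> (SUP \<delta>\<in>{0<..}. INF y\<in>cball x \<delta> - {x}. ?q y)"
  proof (rule SUP_mono)
    fix e :: real assume "e \<in> {0<..}"
    then have "e / 2 \<in> {0<..}" "cball x (e / 2) - {x} \<subseteq> ball x e - {x}"
      by auto
    then show "\<exists>\<delta>\<in>{0<..}. (INF y\<in>ball x e - {x}. ?q y) \<le> (INF y\<in>cball x \<delta> - {x}. ?q y)"
      by (meson INF_superset_mono order_refl)
  qed
  show "(SUP \<delta>\<in>{0<..}. INF y\<in>cball x \<delta> - {x}. ?q y)
      \<le> (SUP e\<in>{0<..}. INF y\<in>ball x e - {x}. ?q y)"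
    by (intro SUP_mono bexI INF_superset_mono Diff_mono ball_subset_cball) auto
qed

definition Argmin :: "('a \<Rightarrow> ereal) \<Rightarrow> 'a set" where
  "Argmin f = {x. f x \<le> (INF y. f y)}"

end

(* If Argmin f were empty, the descent rate would be below -\<sigma> at every point z of the
   effective domain, so each such z would admit y \<noteq> z with f y + \<sigma> d(z,y) \<le> f z. This contradicts
   Ekeland's variational principle, which provides a z with f z < f y + \<sigma> d(z,y) for all y \<noteq> z. *)
theory Submission
  imports Defs
begin

text \<open>If \<open>c < f z\<close>, lower semicontinuity keeps \<open>f\<close> above
  \<open>c\<close> on a neighbourhood of \<open>z\<close>, which \<open>X\<close> eventually enters.
  The filter \<open>at z\<close> leaves out \<open>z\<close> itself, a value \<open>X\<close> may
  take; \<open>c < f z\<close> fills this gap and gives the statement for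
  \<open>nhds z\<close>.\<close>

lemma lower_semicontinuous_LIMSEQ_le:
  fixes f :: "'a::topological_space \<Rightarrow> ereal"
  assumes "lower_semicontinuous f" "X \<longlonglongrightarrow> z" "eventually (\<lambda>n. f (X n) \<le> c) sequentially"
  shows "f z \<le> c"
proof (rule ccontr)
  assume "\<not> f z \<le> c"
  then have "c < f z"
    by simp
  moreover have "f z \<le> Liminf (at z) f"
    using assms(1) by (auto simp: lower_semicontinuous_def)
  ultimately have "eventually (\<lambda>y. c < f y) (at z)"
    by (intro less_LiminfD) auto
  with \<open>c < f z\<close> have "eventually (\<lambda>y. c < f y) (nhds z)"
    unfolding eventually_at_filter by (auto elim!: eventually_mono)
  then have "eventually (\<lambda>n. c < f (X n)) sequentially"
    using assms(2) by (auto simp: filterlim_iff)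
  with assms(3) have "eventually (\<lambda>n. False) sequentially"
    by eventually_elim auto
  then show False
    by simp
qed

text \<open>The sets \<open>S x\<close> are the lower sections of a transitive relation.
  Near-minimizers chosen in successive sections form a Cauchy sequence, and its limit has no other
  point in its own section.\<close>

lemma Ekeland_variational_principle:
  fixes f :: "'a::complete_space \<Rightarrow> ereal"
  assumes lsc: "lower_semicontinuous f" and bdd: "(INF x. f x) > -\<infinity>"
    and "f x0 < \<infinity>" and "\<sigma> > 0"
  obtains z where "f z < \<infinity>" and "\<And>y. y \<noteq> z \<Longrightarrow> f z < f y + ereal (\<sigma> * dist z y)"
proof -
  \<comment> \<open>\<open>real_of_ereal\<close> sends infinity to 0, so \<open>a\<close> represents
    \<open>f\<close> only where \<open>f\<close> is finite. This is why \<open>S\<close> also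
    demands \<open>f y < \<infinity>\<close>.\<close>
  define a where "a x = real_of_ereal (f x)" for x
  define S where "S x = {y. f y < \<infinity> \<and> a y + \<sigma> * dist x y \<le> a x}" for x
  have inf_le: "(INF x. f x) \<le> f x" for x
    by (rule INF_lower) simp
  have f_eq: "f x = ereal (a x)" if "f x < \<infinity>" for x
    using that inf_le[of x] bdd by (cases "f x") (auto simp: a_def)
  have "(INF x. f x) < \<infinity>"
    using inf_le[of x0] assms(3) by (rule le_less_trans)
  with bdd obtain B where "(INF x. f x) = ereal B"
    by (cases "INF x. f x") auto
  then have a_ge: "B \<le> a x" if "f x < \<infinity>" for x
    using inf_le[of x] f_eq[OF that] by simp
  have S_trans: "w \<in> S x" if "y \<in> S x" "w \<in> S y" for x y w
  proof -
    have "\<sigma> * dist x w \<le> \<sigma> * (dist x y + dist y w)"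
      using \<open>\<sigma> > 0\<close> by (intro mult_left_mono dist_triangle) auto
    with that show ?thesis
      by (auto simp: S_def algebra_simps)
  qed
  \<comment> \<open>The infimum of \<open>a\<close> over \<open>S x\<close> need not be attained,
    hence the slack \<open>(1/2) ^ n\<close>, which vanishes in the limit.\<close>
  have step: "\<exists>y. y \<in> S x \<and> (\<forall>w\<in>S x. a y \<le> a w + (1/2) ^ n)" if "f x < \<infinity>" for x n
  proof -
    have "x \<in> S x"
      using that by (auto simp: S_def)
    then have "a ` S x \<noteq> {}"
      by auto
    moreover have bb: "bdd_below (a ` S x)"
      by (rule bdd_belowI[of _ B]) (auto simp: S_def a_ge)
    moreover have "Inf (a ` S x) < Inf (a ` S x) + (1/2) ^ n"
      by simp
    ultimately obtain y where y: "y \<in> S x" "a y < Inf (a ` S x) + (1/2) ^ n"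
      using cInf_lessD[of "a ` S x" "Inf (a ` S x) + (1/2) ^ n"] by blast
    have "Inf (a ` S x) \<le> a w" if "w \<in> S x" for w
      using bb that by (intro cInf_lower) auto
    with y show ?thesis
      by force
  qed
  have "\<exists>X. \<forall>n. f (X n) < \<infinity> \<and> (X (Suc n) \<in> S (X n) \<and> (\<forall>w\<in>S (X n). a (X (Suc n)) \<le> a w + (1/2) ^ n))"
  proof (rule dependent_nat_choice)
    show "\<exists>x. f x < \<infinity>"
      using assms(3) by blast
  next
    fix x n assume "f x < \<infinity>"
    from step[OF this, of n] show "\<exists>y. f y < \<infinity> \<and> y \<in> S x \<and> (\<forall>w\<in>S x. a y \<le> a w + (1/2) ^ n)"
      by (auto simp: S_def)
  qed
  then obtain X where X: "f (X n) < \<infinity>" "X (Suc n) \<in> S (X n)"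
      and X_min: "\<And>w. w \<in> S (X n) \<Longrightarrow> a (X (Suc n)) \<le> a w + (1/2) ^ n" for n
    by blast
  have X_S: "X m \<in> S (X n)" if "n \<le> m" for m n
    using that
  proof (induction rule: dec_induct)
    case base
    show ?case
      using X(1) by (simp add: S_def)
  next
    case (step m)
    then show ?case
      using S_trans X(2) by blast
  qed
  have "decseq (\<lambda>n. a (X n))"
  proof (rule decseq_SucI)
    fix n
    have "0 \<le> \<sigma> * dist (X n) (X (Suc n))"
      using \<open>\<sigma> > 0\<close> by simp
    with X(2)[of n] show "a (X (Suc n)) \<le> a (X n)"
      by (auto simp: S_def)
  qed
  then obtain L where "(\<lambda>n. a (X n)) \<longlonglongrightarrow> L"
    using decseq_convergent[of "\<lambda>n. a (X n)" B] a_ge[OF X(1)] by blast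
  then have aC: "Cauchy (\<lambda>n. a (X n))"
    by (rule LIMSEQ_imp_Cauchy)
  \<comment> \<open>Membership in \<open>S (X n)\<close> bounds \<open>\<sigma>\<close> times the
    distance by the drop of \<open>a\<close>, and the values of \<open>a\<close> along
    \<open>X\<close> already form a Cauchy sequence.\<close>
  have "Cauchy X"
  proof (rule metric_CauchyI)
    fix e :: real assume "e > 0"
    with \<open>\<sigma> > 0\<close> obtain N where N: "\<And>m n. m \<ge> N \<Longrightarrow> n \<ge> N \<Longrightarrow> dist (a (X m)) (a (X n)) < \<sigma> * e"
      using metric_CauchyD[OF aC, of "\<sigma> * e"] by auto
    have le: "dist (X n) (X m) < e" if "N \<le> n" "n \<le> m" for m n
    proof -
      have "\<sigma> * dist (X n) (X m) \<le> a (X n) - a (X m)"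
        using X_S[OF that(2)] by (auto simp: S_def)
      also have "\<dots> < \<sigma> * e"
        using N[of n m] that by (auto simp: dist_real_def)
      finally show ?thesis
        using \<open>\<sigma> > 0\<close> by simp
    qed
    have "dist (X m) (X n) < e" if "m \<ge> N" "n \<ge> N" for m n
      using le[of m n] le[of n m] that by (cases "m \<le> n") (auto simp: dist_commute)
    then show "\<exists>M. \<forall>m\<ge>M. \<forall>n\<ge>M. dist (X m) (X n) < e"
      by blast
  qed
  then obtain z where z: "X \<longlonglongrightarrow> z"
    using Cauchy_convergent convergent_def by blast
  \<comment> \<open>This passes to the limit in \<open>X m \<in> S (X n)\<close> as \<open>m\<close>
    grows. The semicontinuity lemma wants a bound independent of \<open>m\<close>, so
    \<open>e\<close> absorbs the error in the distance.\<close>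
  have fz: "f z \<le> ereal (a (X n) - \<sigma> * dist (X n) z)" for n
  proof (rule ereal_le_epsilon2)
    fix e :: real assume "e > 0"
    have "(\<lambda>m. \<sigma> * dist (X n) (X m)) \<longlonglongrightarrow> \<sigma> * dist (X n) z"
      by (intro tendsto_intros z)
    then have "eventually (\<lambda>m. \<sigma> * dist (X n) (X m) > \<sigma> * dist (X n) z - e) sequentially"
      using \<open>e > 0\<close> by (intro order_tendstoD) auto
    then have "eventually (\<lambda>m. f (X m) \<le> ereal (a (X n) - \<sigma> * dist (X n) z + e)) sequentially"
      using eventually_ge_at_top[of n]
    proof eventually_elim
      case (elim m)
      with X_S[of n m] show ?case
        by (auto simp: S_def f_eq)
    qed
    from lower_semicontinuous_LIMSEQ_le[OF lsc z this]
    show "f z \<le> ereal (a (X n) - \<sigma> * dist (X n) z) + ereal e"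
      by simp
  qed
  have z_dom: "f z < \<infinity>"
    using fz[of 0] by (rule le_less_trans) simp
  have z_S: "z \<in> S (X n)" for n
    using fz[of n] z_dom by (auto simp: S_def f_eq)
  \<comment> \<open>A counterexample \<open>y\<close> lies in \<open>S z\<close>, hence in every
    \<open>S (X n)\<close>. Near-minimality of \<open>X (Suc n)\<close> then forces
    \<open>a z \<le> a y\<close>, against the positive gap
    \<open>\<sigma> * dist z y\<close>.\<close>
  have "f z < f y + ereal (\<sigma> * dist z y)" if "y \<noteq> z" for y
  proof (rule ccontr)
    assume "\<not> ?thesis"
    then have le: "f y + ereal (\<sigma> * dist z y) \<le> f z"
      by simp
    then have y_dom: "f y < \<infinity>"
      using z_dom by (cases "f y") auto
    with le z_dom have "a y + \<sigma> * dist z y \<le> a z"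
      by (simp add: f_eq)
    then have "y \<in> S z"
      using y_dom by (simp add: S_def)
    then have "a (X (Suc n)) \<le> a y + (1/2) ^ n" for n
      using S_trans z_S X_min by blast
    moreover have "a z \<le> a (X (Suc n))" for n
    proof -
      have "0 \<le> \<sigma> * dist (X (Suc n)) z"
        using \<open>\<sigma> > 0\<close> by simp
      with z_S[of "Suc n"] show ?thesis
        by (auto simp: S_def)
    qed
    ultimately have "a z \<le> a y + (1/2) ^ n" for n
      using order_trans by blast
    moreover have "(\<lambda>n. a y + (1/2) ^ n) \<longlonglongrightarrow> a y + 0"
      by (intro tendsto_intros LIMSEQ_power_zero) simp
    ultimately have "a z \<le> a y"
      by (intro LIMSEQ_le_const[where X = "\<lambda>n. a y + (1/2) ^ n"]) auto
    moreover have "0 < \<sigma> * dist z y"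
      using \<open>\<sigma> > 0\<close> \<open>y \<noteq> z\<close> by simp
    ultimately show False
      using \<open>a y + \<sigma> * dist z y \<le> a z\<close> by simp
  qed
  with z_dom that show thesis
    by blast
qed

text \<open>Otherwise \<open>c\<close> would bound the quotient from below at every point other than
  \<open>z\<close>, and so bound its lower limit. Only one point is extracted, with no control on
  its distance to \<open>z\<close>.\<close>

lemma steepest_descent_rate_lessE:
  assumes "steepest_descent_rate f z < c"
  obtains y where "y \<noteq> z" "(f y - f z) / ereal (dist y z) < c"
proof -
  have "\<exists>y. y \<noteq> z \<and> (f y - f z) / ereal (dist y z) < c"
  proof (rule ccontr)
    assume "\<not> ?thesis"
    then have "eventually (\<lambda>y. c \<le> (f y - f z) / ereal (dist y z)) (at z)"
      by (auto simp: eventually_at_filter not_less intro!: always_eventually)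
    then have "c \<le> steepest_descent_rate f z"
      unfolding steepest_descent_rate_def by (rule Liminf_bounded)
    with assms show False
      by simp
  qed
  with that show thesis
    by blast
qed

theorem proposition3:
  fixes f :: "'a::complete_space \<Rightarrow> ereal"
  assumes "\<And>x. f x \<noteq> -\<infinity>"
    and "lower_semicontinuous f"
    and "(INF x. f x) > -\<infinity>"
    and "\<exists>\<sigma>::real. \<sigma> > 0 \<and>
      (SUP x\<in>{x. f x > (INF y. f y) \<and> f x < \<infinity>}. steepest_descent_rate f x) < - ereal \<sigma>"
  shows "Argmin f \<noteq> {}"
proof
  assume "Argmin f = {}"
  then have inf_less: "(INF y. f y) < f x" for x
    by (auto simp: Argmin_def not_le)
  \<comment> \<open>Types are inhabited, so \<open>undefined\<close> serves as a point of the space;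
    strictness of \<open>inf_less\<close> there excludes an infinite infimum.\<close>
  then have "(INF y. f y) < \<infinity>"
    by (rule less_le_trans[of _ "f undefined"]) simp
  then obtain x0 where "f x0 < \<infinity>"
    unfolding INF_less_iff by blast
  obtain \<sigma> :: real where "\<sigma> > 0"
    and sup: "(SUP x\<in>{x. f x > (INF y. f y) \<and> f x < \<infinity>}. steepest_descent_rate f x) < - ereal \<sigma>"
    using assms(4) by blast
  obtain z where z: "f z < \<infinity>" and z_min: "\<And>y. y \<noteq> z \<Longrightarrow> f z < f y + ereal (\<sigma> * dist z y)"
    using Ekeland_variational_principle[OF assms(2,3) \<open>f x0 < \<infinity>\<close> \<open>\<sigma> > 0\<close>] by blast
  \<comment> \<open>Since no point attains the infimum, \<open>z\<close> belongs to the index set of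
    the supremum.\<close>
  have "steepest_descent_rate f z < - ereal \<sigma>"
    using inf_less z by (intro le_less_trans[OF SUP_upper sup]) auto
  then obtain y where "y \<noteq> z" and y: "(f y - f z) / ereal (dist y z) < - ereal \<sigma>"
    by (rule steepest_descent_rate_lessE)
  obtain r where r: "f z = ereal r"
    using z assms(1)[of z] by (cases "f z") auto
  show False
  proof (cases "f y")
    case (real s)
    have "(s - r) / dist y z < - \<sigma>"
      using y \<open>y \<noteq> z\<close> by (simp add: real r)
    then have "s - r < - \<sigma> * dist y z"
      using \<open>y \<noteq> z\<close> by (simp add: pos_divide_less_eq)
    with z_min[OF \<open>y \<noteq> z\<close>] show False
      by (simp add: real r dist_commute)
  next
    \<comment> \<open>Here the quotient is infinite, as \<open>f z\<close> is finite and the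
      distance is positive.\<close>
    case PInf
    with y \<open>y \<noteq> z\<close> show False
      by (simp add: r)
  next
    case MInf
    with assms(1) show False
      by blast
  qed
qed

end
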